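(* Let the sample size $n$ and the data $X,Y$ be fixed. Suppose that for each $m$ the quantile levels $0<\tau_1<\cdots<\tau_m<1$ (depending on $m$) satisfy $\max_{0\le j\le m}(\tau_{j+1}-\tau_j)=O(1/m)$, where $\tau_0=0$ and $\tau_{m+1}=1$. Then $$\bigl\|\hat p_m(B_m|X,Y)-p(B_m|X,Y)\bigr\|_{\mathrm{TV}}\to 0\qquad\text{as } m\to\infty,$$ where $\hat p_m(B_m|X,Y)$ is the posterior distribution of $B_m=(\beta(\tau_1),\dots,\beta(\tau_m))$ based on the linearly interpolated density and $p(B_m|X,Y)$ is the posterior based on the integrated likelihood.
   Context: Data: $X=(x_1,\dots,x_n)'$ with $x_i\in\mathbb R^p$ (first component $1$), $Y=(y_1,\dots,y_n)\in\mathbb R^n$. Quantile regression model: the $\tau$-th conditional quantile of $y$ given $x_i$ is $x_i^T\beta(\tau)$, where $\beta(\cdot)$ is an $\mathbb R^p$-valued function of $\tau$; $f_i$ denotes the density of $y|x_i$, so $f_i$ is determined by its quantile function $\tau\mapsto x_i^T\beta(\tau)$. Write $\theta_{m,i}=x_iB_m=(x_i^T\beta(\tau_1),\dots,x_i^T\beta(\tau_m))$. Class of densities: for fixed constants $M_1,M_2,c$, and with $q_{f,\tau}$ the $\tau$-th quantile of $f$, $\mathscr F$ is the set of probability densities $f$ on $\mathbb R$ with $0\le f\le M_1$, $|f'|<M_2$, and, for every $m=2,3,\dots$, $f(x)<c/\sqrt m$ for $x<q_{f,1/m}$ and for $x>q_{f,(m-1)/m}$. It is assumed that each $f_i\in\mathscr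 F$. $\mathscr F_{\theta_{m,i}}$ is the set of $f\in\mathscr F$ whose quantiles at levels $\tau_1,\dots,\tau_m$ equal $\theta_{m,i}$. Priors: a Gaussian process prior is put on $\beta''(\cdot)$ (so that $\beta$ has a second derivative and the $f_i$ have a first derivative), giving a prior on $\beta(\cdot)$. It induces: the prior $\Pi$ on each $f_i\in\mathscr F$; the prior $\Pi_{\theta_{m,i}}$ on $f_i\in\mathscr F_{\theta_{m,i}}$ given $\theta_{m,i}$, induced by $\Pi$; and the prior $\pi_m(B_m|X)$ on $B_m$, which is a vector of $m$ points on $\beta(\cdot)$. Integrated likelihood and target posterior: $p(y_i|x_i,B_m)=\int_{f_i\in\mathscr F_{\theta_{m,i}}} f_i(y_i)\,d\Pi_{\theta_{m,i}}(f_i)$, $p(Y|X,B_m)=\prod_{i=1}^n p(y_i|x_i,B_m)$, $p(Y|X)=\int\pi_m(B_m|X)p(Y|X,B_m)\,dB_m$, and $p(B_m|X,Y)=\pi_m(B_m|X)p(Y|X,B_m)/p(Y|X)$. With these priors the quantities $p(y_i|x_i,B_m)$ and $p(B_m|X,Y)$ are taken to be well defined. Approximate posterior: for a pre-specified parameter $\sigma^2>0$, $$\hat f_i(y|x_i,B_m)=\sum_{j=1}^{m-1} I_{\{x_i\beta(\tau_j)\le y<x_i\beta(\tau_{j+1})\}}\frac{\tau_{j+1}-\tau_j}{x_i\beta(\tau_{j+1})-x_i\beta(\tau_j)}+I_{\{y<x_i\beta(\tau_1)\}}\tau_1f_1(y)+I_{\{y\ge x_i\beta(\tau_m)\}}(1-\tau_m)f_2(y),$$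 where $x_i\beta(\tau_j)$ means $x_i^T\beta(\tau_j)$, $f_1$ is the density of the left half of $N(x_i\beta(\tau_1),\sigma^2)$ (conditioned to lie below its mean), and $f_2$ is the density of the right half of $N(x_i\beta(\tau_m),\sigma^2)$ (conditioned to lie above its mean). Set $\hat p_m(Y|X,B_m)=\prod_{i=1}^n\hat f_i(y_i|x_i,B_m)$, $\hat p_m(Y|X)=\int\pi_m(B_m|X)\hat p_m(Y|X,B_m)\,dB_m$, and $\hat p_m(B_m|X,Y)=\pi_m(B_m|X)\hat p_m(Y|X,B_m)/\hat p_m(Y|X)$. Total variation norm: $\|\mu_1-\mu_2\|_{\mathrm{TV}}=\sup_A|\mu_1(A)-\mu_2(A)|$ over measurable sets $A$.
   Formalization: The m-free evidence p(Y|X) is read as the prior mean of the product of the f_i(y_i) and assumed positive (for n≥2 positivity of the normaliser for each m is not enough); the prior is the Gaussian process law conditioned on all f_i lying in the class. *)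

theory Defs
  imports "HOL-Probability.Probability" "HOL-Library.Landau_Symbols"
begin

section \<open>Densities and quantiles\<close>

definition quantile :: "(real \<Rightarrow> real) \<Rightarrow> real \<Rightarrow> real" where
  "quantile f t = Inf {x. t \<le> cdf (density lborel (\<lambda>u. ennreal (f u))) x}"

definition density_class :: "real \<Rightarrow> real \<Rightarrow> real \<Rightarrow> (real \<Rightarrow> real) set" where
  "density_class M1 M2 c = {f.
     has_bochner_integral lborel f 1 \<and>
     (\<forall>x. 0 \<le> f x \<and> f x \<le> M1) \<and>
     (\<forall>x. f differentiable (at x) \<and> \<bar>deriv f x\<bar> < M2) \<and>
     (\<forall>m::nat. 2 \<le> m \<longrightarrow>
        (\<forall>x. x < quantile f (1 / real m) \<longrightarrow> f x < c / sqrt (real m)) \<and>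
        (\<forall>x. quantile f ((real m - 1) / real m) < x \<longrightarrow> f x < c / sqrt (real m)))}"

text \<open>Densities are random elements of the cylinder \<open>\<sigma>\<close>-algebra, the one generated by
  the evaluations at points of the real line.\<close>

definition density_space :: "(real \<Rightarrow> real) set \<Rightarrow> (real \<Rightarrow> real) measure" where
  "density_space F = restrict_space (PiM UNIV (\<lambda>_. borel)) F"

text \<open>The fibre \<open>F\<^sub>\<theta>\<close>; only the entries \<open>1, \<dots>, m\<close> of \<open>\<tau>\<close> and \<open>\<theta>\<close> are used.\<close>

definition density_fibre ::
  "(real \<Rightarrow> real) set \<Rightarrow> nat \<Rightarrow> (nat \<Rightarrow> real) \<Rightarrow> (nat \<Rightarrow> real) \<Rightarrow> (real \<Rightarrow> real) set" where
  "density_fibre F m \<tau> \<theta> = {f \<in> F. \<forall>j\<in>{1..m}. quantile f (\<tau> j) = \<theta> j}"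

definition has_quantile_function :: "(real \<Rightarrow> real) \<Rightarrow> (real \<Rightarrow> real) \<Rightarrow> bool" where
  "has_quantile_function f Q \<longleftrightarrow> (\<forall>t\<in>{0<..<1}. quantile f t = Q t)"

text \<open>Elements of a density class are continuous, so the quantile function determines
  the density and the description below is unique whenever such a density exists.\<close>

definition density_of :: "(real \<Rightarrow> real) set \<Rightarrow> (real \<Rightarrow> real) \<Rightarrow> (real \<Rightarrow> real)" where
  "density_of F Q = (THE f. f \<in> F \<and> has_quantile_function f Q)"


section \<open>The prior\<close>

text \<open>Point masses count as (degenerate) normal distributions, as usual for Gaussian processes.\<close>

definition gaussian_rv :: "'w measure \<Rightarrow> ('w \<Rightarrow> real) \<Rightarrow> bool" where
  "gaussian_rv M Z \<longleftrightarrow> Z \<in> borel_measurable M \<and>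
     ((\<exists>\<mu> \<sigma>. 0 < \<sigma> \<and> distributed M lborel Z (normal_density \<mu> \<sigma>)) \<or>
      (\<exists>\<mu>. AE \<omega> in M. Z \<omega> = \<mu>))"

definition gaussian_process ::
  "'w measure \<Rightarrow> 't set \<Rightarrow> ('w \<Rightarrow> 't \<Rightarrow> 'v::euclidean_space) \<Rightarrow> bool" where
  "gaussian_process M T G \<longleftrightarrow>
     (\<forall>J a. finite J \<and> J \<subseteq> T \<longrightarrow> gaussian_rv M (\<lambda>\<omega>. \<Sum>t\<in>J. a t \<bullet> G \<omega> t))"

text \<open>A random coefficient function on \<open>(0,1)\<close> whose second derivative is a Gaussian process.
  The law of the two constants of integration, and their dependence on the second derivative,
  is left arbitrary.\<close>

definition gp_prior :: "'w measure \<Rightarrow> ('w \<Rightarrow> real \<Rightarrow> 'v::euclidean_space) \<Rightarrow> bool" where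
  "gp_prior M \<beta> \<longleftrightarrow> prob_space M \<and>
     (\<forall>t\<in>{0<..<1}. (\<lambda>\<omega>. \<beta> \<omega> t) \<in> borel_measurable M) \<and>
     (\<exists>\<beta>' \<beta>''.
        (\<forall>\<omega>\<in>space M. \<forall>t\<in>{0<..<1}.
           (\<beta> \<omega> has_vector_derivative \<beta>' \<omega> t) (at t) \<and>
           (\<beta>' \<omega> has_vector_derivative \<beta>'' \<omega> t) (at t)) \<and>
        gaussian_process M {0<..<1} \<beta>'')"

text \<open>A Gaussian path need not yield increasing quantile functions, let alone densities in
  \<open>F\<close>. The prior is therefore the Gaussian process law conditioned on the event that every
  \<open>x\<^sub>i \<bullet> \<beta>\<close> is the quantile function of a density in \<open>F\<close>. If that event has
  probability one, the conditioning does nothing.\<close>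

definition model_event ::
  "'w measure \<Rightarrow> ('w \<Rightarrow> real \<Rightarrow> 'v::euclidean_space) \<Rightarrow> (real \<Rightarrow> real) set
     \<Rightarrow> nat \<Rightarrow> (nat \<Rightarrow> 'v) \<Rightarrow> 'w set" where
  "model_event M \<beta> F n x =
     {\<omega> \<in> space M. \<forall>i<n. \<exists>f\<in>F. has_quantile_function f (\<lambda>t. x i \<bullet> \<beta> \<omega> t)}"

definition conditioned_on :: "'w measure \<Rightarrow> 'w set \<Rightarrow> 'w measure" where
  "conditioned_on M E = uniform_measure (restrict_space M E) E"

definition cond_density ::
  "('w \<Rightarrow> real \<Rightarrow> 'v::euclidean_space) \<Rightarrow> (real \<Rightarrow> real) set \<Rightarrow> (nat \<Rightarrow> 'v)
     \<Rightarrow> nat \<Rightarrow> 'w \<Rightarrow> real \<Rightarrow> real" where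
  "cond_density \<beta> F x i \<omega> = density_of F (\<lambda>t. x i \<bullet> \<beta> \<omega> t)"

definition density_prior ::
  "'w measure \<Rightarrow> ('w \<Rightarrow> real \<Rightarrow> 'v::euclidean_space) \<Rightarrow> (real \<Rightarrow> real) set
     \<Rightarrow> (nat \<Rightarrow> 'v) \<Rightarrow> nat \<Rightarrow> (real \<Rightarrow> real) measure" where
  "density_prior P \<beta> F x i = distr P (density_space F) (cond_density \<beta> F x i)"

text \<open>A point \<open>B\<close> of \<open>coef_prior\<close> is \<open>(\<beta>(\<tau>\<^sub>1), \<dots>, \<beta>(\<tau>\<^sub>m))\<close>, a function on \<open>{1..m}\<close>.\<close>

definition coef_prior ::
  "'w measure \<Rightarrow> ('w \<Rightarrow> real \<Rightarrow> 'v::euclidean_space) \<Rightarrow> nat \<Rightarrow> (nat \<Rightarrow> real)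
     \<Rightarrow> (nat \<Rightarrow> 'v) measure" where
  "coef_prior P \<beta> m \<tau> =
     distr P (PiM {1..m} (\<lambda>_. borel)) (\<lambda>\<omega>. \<lambda>j\<in>{1..m}. \<beta> \<omega> (\<tau> j))"

definition fitted :: "(nat \<Rightarrow> 'v::euclidean_space) \<Rightarrow> nat \<Rightarrow> nat \<Rightarrow> (nat \<Rightarrow> 'v) \<Rightarrow> nat \<Rightarrow> real" where
  "fitted x i m B = (\<lambda>j\<in>{1..m}. x i \<bullet> B j)"

definition fitted_prior ::
  "'w measure \<Rightarrow> ('w \<Rightarrow> real \<Rightarrow> 'v::euclidean_space) \<Rightarrow> (nat \<Rightarrow> 'v) \<Rightarrow> nat \<Rightarrow> nat
     \<Rightarrow> (nat \<Rightarrow> real) \<Rightarrow> (nat \<Rightarrow> real) measure" where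
  "fitted_prior P \<beta> x i m \<tau> =
     distr (coef_prior P \<beta> m \<tau>) (PiM {1..m} (\<lambda>_. borel)) (fitted x i m)"

text \<open>\<open>K\<close> disintegrates \<open>R\<close> over \<open>N\<close>: it is a probability kernel, \<open>K \<theta>\<close> lives on the fibre
  over \<open>\<theta>\<close> for almost every \<open>\<theta>\<close>, and averaging \<open>K \<theta>\<close> over \<open>N\<close> gives \<open>R\<close>.\<close>

definition disintegration ::
  "'b measure \<Rightarrow> 'a measure \<Rightarrow> ('a \<Rightarrow> 'b set) \<Rightarrow> ('a \<Rightarrow> 'b measure) \<Rightarrow> bool" where
  "disintegration R N fib K \<longleftrightarrow>
     K \<in> N \<rightarrow>\<^sub>M prob_algebra R \<and>
     (AE \<theta> in N. emeasure (K \<theta>) (fib \<theta>) = 1) \<and>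
     R = N \<bind> K"


section \<open>Likelihoods and posteriors\<close>

text \<open>\<open>K i \<theta>\<close> is the prior on the \<open>i\<close>-th density given its quantiles \<open>\<theta>\<close> at the levels \<open>\<tau>\<close>.\<close>

definition integrated_likelihood ::
  "(real \<Rightarrow> real) set \<Rightarrow> (nat \<Rightarrow> (nat \<Rightarrow> real) \<Rightarrow> (real \<Rightarrow> real) measure) \<Rightarrow> nat
     \<Rightarrow> (nat \<Rightarrow> 'v::euclidean_space) \<Rightarrow> (nat \<Rightarrow> real) \<Rightarrow> nat \<Rightarrow> (nat \<Rightarrow> real)
     \<Rightarrow> (nat \<Rightarrow> 'v) \<Rightarrow> real" where
  "integrated_likelihood F K n x y m \<tau> B =
     (\<Prod>i<n. LINT f : density_fibre F m \<tau> (fitted x i m B) | K i (fitted x i m B). f (y i))"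

text \<open>Densities of the normal law with variance \<open>\<sigma>\<^sup>2\<close> conditioned to lie on one side of
  its mean, an event of probability 1/2.\<close>

definition left_half_normal :: "real \<Rightarrow> real \<Rightarrow> real \<Rightarrow> real" where
  "left_half_normal \<mu> \<sigma> y = 2 * normal_density \<mu> \<sigma> y * indicator {..<\<mu>} y"

definition right_half_normal :: "real \<Rightarrow> real \<Rightarrow> real \<Rightarrow> real" where
  "right_half_normal \<mu> \<sigma> y = 2 * normal_density \<mu> \<sigma> y * indicator {\<mu>..} y"

definition interp_density ::
  "real \<Rightarrow> nat \<Rightarrow> (nat \<Rightarrow> real) \<Rightarrow> (nat \<Rightarrow> real) \<Rightarrow> real \<Rightarrow> real" where
  "interp_density \<sigma> m \<tau> \<theta> y =
     (\<Sum>j\<in>{1..<m}. indicator {\<theta> j..<\<theta> (Suc j)} y * ((\<tau> (Suc j) - \<tau> j) / (\<theta> (Suc j) - \<theta> j)))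
     + indicator {..<\<theta> 1} y * (\<tau> 1 * left_half_normal (\<theta> 1) \<sigma> y)
     + indicator {\<theta> m..} y * ((1 - \<tau> m) * right_half_normal (\<theta> m) \<sigma> y)"

definition interp_likelihood ::
  "real \<Rightarrow> nat \<Rightarrow> (nat \<Rightarrow> 'v::euclidean_space) \<Rightarrow> (nat \<Rightarrow> real) \<Rightarrow> nat \<Rightarrow> (nat \<Rightarrow> real)
     \<Rightarrow> (nat \<Rightarrow> 'v) \<Rightarrow> real" where
  "interp_likelihood \<sigma> n x y m \<tau> B = (\<Prod>i<n. interp_density \<sigma> m \<tau> (fitted x i m B) (y i))"

definition posterior :: "'b measure \<Rightarrow> ('b \<Rightarrow> real) \<Rightarrow> 'b measure" where
  "posterior \<pi> L = density \<pi> (\<lambda>B. ennreal (L B / (\<integral>B'. L B' \<partial>\<pi>)))"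

definition tv_dist :: "'b measure \<Rightarrow> 'b measure \<Rightarrow> real" where
  "tv_dist \<mu> \<nu> = (SUP A\<in>sets \<mu>. \<bar>measure \<mu> A - measure \<nu> A\<bar>)"

end

theory Submission
  imports Defs
begin

text \<open>A density \<open>f\<close> of the class has \<open>\<bar>(f\<^sup>2)'\<bar> \<le> 2 M\<^sub>2 f\<close>, hence its oscillation over an interval of mass
  \<open>1/k\<close> is at most \<open>sqrt (2 M\<^sub>2 / k)\<close>, whatever the length of the interval. On a cell between two
  quantiles the interpolated density is the mean of \<open>f\<close>, and beyond the extreme quantiles both
  densities are \<open>O(1/sqrt k)\<close>, so the interpolation error is \<open>O(1/sqrt k)\<close> uniformly over the class
  as soon as the mesh is below \<open>1/k\<close>. Averaging over a fibre, on which the interpolated density is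
  constant, transfers this bound to the integrated likelihood almost everywhere. Both evidences
  therefore converge to the evidence of the full model, which is positive, and the posteriors
  merge.\<close>

section \<open>Densities in the class\<close>

abbreviation dcdf :: "(real \<Rightarrow> real) \<Rightarrow> real \<Rightarrow> real" where
  "dcdf f \<equiv> cdf (density lborel (\<lambda>u. ennreal (f u)))"

lemma density_classD:
  assumes "f \<in> density_class M1 M2 c"
  shows "integrable lborel f" "integral\<^sup>L lborel f = 1" "0 \<le> f x" "f x \<le> M1"
    "(f has_real_derivative deriv f x) (at x)" "\<bar>deriv f x\<bar> < M2"
  using assms by (auto simp: density_class_def has_bochner_integral_iff DERIV_deriv_iff_real_differentiable)

lemma density_class_tails:
  assumes "f \<in> density_class M1 M2 c" "2 \<le> k"
  shows "x < quantile f (1 / real k) \<Longrightarrow> f x < c / sqrt (real k)"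
    "quantile f ((real k - 1) / real k) < x \<Longrightarrow> f x < c / sqrt (real k)"
  using assms by (auto simp: density_class_def)

lemma real_distribution_density_class:
  assumes f: "f \<in> density_class M1 M2 c"
  shows "real_distribution (density lborel (\<lambda>u. ennreal (f u)))"
proof -
  note [measurable] = borel_measurable_integrable[OF density_classD(1)[OF f]]
  have "emeasure (density lborel (\<lambda>u. ennreal (f u))) UNIV = (\<integral>\<^sup>+ u. ennreal (f u) \<partial>lborel)"
    by (simp add: emeasure_density)
  also have "\<dots> = 1"
    using density_classD(2,3)[OF f] by (subst nn_integral_eq_integral[OF density_classD(1)[OF f]]) auto
  finally show ?thesis
    by (auto simp: real_distribution_def real_distribution_axioms_def intro!: prob_spaceI)
qed

lemma dcdf_eq_integral:
  assumes f: "f \<in> density_class M1 M2 c"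
  shows "dcdf f a = (\<integral>u. indicator {..a} u * f u \<partial>lborel)"
proof -
  note [measurable] = borel_measurable_integrable[OF density_classD(1)[OF f]]
  have i: "integrable lborel (\<lambda>u. indicator {..a} u * f u)"
    using integrable_mult_indicator[OF _ density_classD(1)[OF f], of "{..a}"] by simp
  have "emeasure (density lborel (\<lambda>u. ennreal (f u))) {..a}
      = (\<integral>\<^sup>+ u. ennreal (indicator {..a} u * f u) \<partial>lborel)"
    by (subst emeasure_density) (auto intro!: nn_integral_cong simp: indicator_def)
  also have "\<dots> = ennreal (\<integral>u. indicator {..a} u * f u \<partial>lborel)"
    using density_classD(3)[OF f] by (intro nn_integral_eq_integral[OF i]) auto
  finally have "emeasure (density lborel (\<lambda>u. ennreal (f u))) {..a}
      = ennreal (\<integral>u. indicator {..a} u * f u \<partial>lborel)" .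
  moreover have "0 \<le> (\<integral>u. indicator {..a} u * f u \<partial>lborel)"
    using density_classD(3)[OF f] by (intro Bochner_Integration.integral_nonneg) auto
  ultimately show ?thesis
    by (metis cdf_def measure_eq_emeasure_eq_ennreal)
qed

text \<open>Members of the class are differentiable, hence continuous, so the fundamental theorem of
  calculus applies at every point. The derivative exists everywhere and not just almost everywhere,
  as the mean value and monotonicity arguments below need.\<close>

lemma has_real_derivative_dcdf:
  assumes f: "f \<in> density_class M1 M2 c"
  shows "(dcdf f has_real_derivative f a) (at a)"
proof -
  have i: "integrable lborel (\<lambda>u. indicator A u * f u)" if "A \<in> sets borel" for A
    using integrable_mult_indicator[OF _ density_classD(1)[OF f], of A] that by simp
  \<comment> \<open>The base point \<open>a - 1\<close> puts \<open>a\<close> in the interior of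
    \<open>{a - 1..a + 1}\<close>, so the derivative within that interval is two-sided.\<close>
  have eq: "dcdf f u = dcdf f (a - 1) + integral {a - 1..u} f" if "a - 1 \<le> u" for u
  proof -
    have "dcdf f u = (\<integral>v. indicator {..a - 1} v * f v + indicator {a - 1<..u} v * f v \<partial>lborel)"
      unfolding dcdf_eq_integral[OF f]
      by (rule Bochner_Integration.integral_cong) (use that in \<open>auto simp: indicator_def\<close>)
    also have "\<dots> = dcdf f (a - 1) + (\<integral>v. indicator {a - 1<..u} v * f v \<partial>lborel)"
      unfolding dcdf_eq_integral[OF f] by (rule Bochner_Integration.integral_add) (auto intro: i)
    also have "(\<integral>v. indicator {a - 1<..u} v * f v \<partial>lborel)
        = (\<integral>v. indicator {a - 1..u} v * f v \<partial>lborel)"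
      using AE_lborel_singleton[of "a - 1"] borel_measurable_integrable[OF density_classD(1)[OF f]]
      by (intro integral_cong_AE) (auto simp: indicator_def)
    also have "\<dots> = integral {a - 1..u} f"
      using set_borel_integral_eq_integral(2)[of "{a - 1..u}" f] i[of "{a - 1..u}"]
      by (simp add: set_integrable_def set_lebesgue_integral_def)
    finally show ?thesis .
  qed
  have c: "continuous_on {a - 1..a + 1} f"
    by (meson density_classD(5)[OF f] DERIV_isCont continuous_at_imp_continuous_on)
  have "((\<lambda>u. integral {a - 1..u} f) has_real_derivative f a) (at a within {a - 1..a + 1})"
    by (rule integral_has_real_derivative[OF c]) simp
  then have "((\<lambda>u. integral {a - 1..u} f) has_real_derivative f a) (at a)"
    by (simp add: at_within_interior[of a "{a - 1..a + 1}"])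
  then have "((\<lambda>u. dcdf f (a - 1) + integral {a - 1..u} f) has_real_derivative f a) (at a)"
    by (auto intro!: derivative_eq_intros)
  then show ?thesis
    by (rule has_field_derivative_transform_within_open[of _ _ _ "{a - 1<..}"]) (auto intro: eq[symmetric])
qed

text \<open>By continuity the superlevel set of the distribution function is closed, so its infimum
  is attained; the intermediate value theorem supplies a point with value exactly \<open>t\<close>,
  and monotonicity does the rest. The density may vanish on intervals, so the distribution function
  need not be injective, and the quantile is the leftmost point of its level set.\<close>

lemma
  assumes f: "f \<in> density_class M1 M2 c" and t: "t \<in> {0<..<1}"
  shows quantile_le_iff: "quantile f t \<le> a \<longleftrightarrow> t \<le> dcdf f a"
    and dcdf_quantile: "dcdf f (quantile f t) = t"
proof -
  interpret real_distribution "density lborel (\<lambda>u. ennreal (f u))"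
    by (rule real_distribution_density_class[OF f])
  let ?S = "{x. t \<le> dcdf f x}"
  have cont: "continuous_on A (dcdf f)" for A
    by (intro continuous_at_imp_continuous_on ballI DERIV_isCont[OF has_real_derivative_dcdf[OF f]])
  have "eventually (\<lambda>x. dcdf f x < t) at_bot" "eventually (\<lambda>x. t < dcdf f x) at_top"
    using t order_tendstoD(2)[OF cdf_lim_at_bot] order_tendstoD(1)[OF cdf_lim_at_top_prob] by auto
  then obtain l u where l: "dcdf f l < t" and u: "t < dcdf f u"
    by (auto simp: eventually_at_bot_linorder eventually_at_top_linorder)
  have "l \<le> u" using l u cdf_nondecreasing[of u l] by linarith
  then obtain z where z: "dcdf f z = t"
    using IVT'[of "dcdf f" l t u] l u cont by fastforce
  have bdd: "bdd_below ?S"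
    using l by (intro bdd_belowI[of _ l]) (smt (verit) cdf_nondecreasing mem_Collect_eq)
  have "closed ?S"
    using continuous_closed_vimage[of "{t..}" "dcdf f"] cont[of UNIV]
    by (simp add: vimage_def continuous_on_eq_continuous_at)
  then have mem: "quantile f t \<in> ?S"
    unfolding quantile_def using z bdd by (intro closed_contains_Inf) auto
  have le: "quantile f t \<le> b" if "t \<le> dcdf f b" for b
    unfolding quantile_def using bdd that by (intro cInf_lower) auto
  show "dcdf f (quantile f t) = t"
    using le[of z] z mem cdf_nondecreasing[of "quantile f t" z] by auto
  show "quantile f t \<le> a \<longleftrightarrow> t \<le> dcdf f a"
    using le mem cdf_nondecreasing[of "quantile f t" a] by auto
qed

text \<open>The distribution function takes the distinct values \<open>s\<close> and
  \<open>t\<close> at the two quantiles. Strictness makes the cell widths positive and places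
  extreme levels inside the tails.\<close>

lemma quantile_less:
  assumes f: "f \<in> density_class M1 M2 c" and "0 < s" "s < t" "t < 1"
  shows "quantile f s < quantile f t"
  using quantile_le_iff[OF f, of t "quantile f s"] dcdf_quantile[OF f, of s] assms by auto

text \<open>Quantiles decide all comparisons of the distribution function with levels in the open
  unit interval, hence determine it. Differentiating then gives equality of the densities at every
  point. This is the uniqueness behind \<open>density_of\<close>.\<close>

lemma density_class_eqI:
  assumes f: "f \<in> density_class M1 M2 c" and g: "g \<in> density_class M1 M2 c"
    and q: "\<And>t. t \<in> {0<..<1} \<Longrightarrow> quantile f t = quantile g t"
  shows "f = g"
proof -
  interpret f: real_distribution "density lborel (\<lambda>u. ennreal (f u))"
    by (rule real_distribution_density_class[OF f])
  interpret g: real_distribution "density lborel (\<lambda>u. ennreal (g u))"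
    by (rule real_distribution_density_class[OF g])
  have iff: "t \<le> dcdf f a \<longleftrightarrow> t \<le> dcdf g a" if "t \<in> {0<..<1}" for t a
    using quantile_le_iff[OF f that] quantile_le_iff[OF g that] q[OF that] by simp
  have "dcdf f a = dcdf g a" for a
  proof (rule ccontr)
    assume "dcdf f a \<noteq> dcdf g a"
    \<comment> \<open>A level strictly between two values in the closed unit interval lies in the
      open one, and it separates the two distribution functions.\<close>
    then obtain t where "min (dcdf f a) (dcdf g a) < t" "t < max (dcdf f a) (dcdf g a)"
      by (metis dense linorder_neq_iff max.strict_order_iff max_def min_def)
    moreover have "0 \<le> dcdf f a" "0 \<le> dcdf g a" "dcdf f a \<le> 1" "dcdf g a \<le> 1"
      using f.cdf_nonneg g.cdf_nonneg f.cdf_bounded_prob g.cdf_bounded_prob by auto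
    ultimately show False
      using iff[of t a] by (auto simp: min_less_iff_disj less_max_iff_disj)
  qed
  then have eq: "dcdf f = dcdf g" by (rule ext)
  show ?thesis
    using DERIV_unique[OF has_real_derivative_dcdf[OF f], unfolded eq, OF has_real_derivative_dcdf[OF g]]
    by (rule ext)
qed

lemma density_of_in:
  assumes "f \<in> density_class M1 M2 c" "has_quantile_function f Q"
  shows "density_of (density_class M1 M2 c) Q \<in> density_class M1 M2 c"
    "has_quantile_function (density_of (density_class M1 M2 c) Q) Q"
proof -
  have "\<exists>!f. f \<in> density_class M1 M2 c \<and> has_quantile_function f Q"
    using assms by (intro ex_ex1I) (auto simp: has_quantile_function_def intro: density_class_eqI)
  from theI'[OF this] show "density_of (density_class M1 M2 c) Q \<in> density_class M1 M2 c"
    "has_quantile_function (density_of (density_class M1 M2 c) Q) Q"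
    unfolding density_of_def by auto
qed

section \<open>Interpolation error\<close>

text \<open>Since \<open>\<bar>(f\<^sup>2)'\<bar> = 2 f \<bar>f'\<bar> \<le> 2 M\<^sub>2 f\<close>, both \<open>2 M\<^sub>2 G + f\<^sup>2\<close> and \<open>2 M\<^sub>2 G - f\<^sup>2\<close> are
  nondecreasing, where \<open>G\<close> is the distribution function. So \<open>f\<close> oscillates little
  over an interval of small mass, however long that interval is.\<close>

lemma density_class_oscillation:
  assumes f: "f \<in> density_class M1 M2 c" and ab: "a \<le> b"
  shows "(f b - f a)\<^sup>2 \<le> 2 * M2 * (dcdf f b - dcdf f a)"
proof -
  have mono: "2 * M2 * dcdf f a + s * (f a)\<^sup>2 \<le> 2 * M2 * dcdf f b + s * (f b)\<^sup>2"
    if s: "s = 1 \<or> s = - 1" for s :: real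
  proof (rule DERIV_nonneg_imp_nondecreasing[OF ab], intro exI conjI)
    fix x
    show "((\<lambda>x. 2 * M2 * dcdf f x + s * (f x)\<^sup>2) has_real_derivative
        2 * f x * (M2 + s * deriv f x)) (at x)"
      using has_real_derivative_dcdf[OF f, of x] density_classD(5)[OF f, of x]
      by (auto intro!: derivative_eq_intros simp: algebra_simps)
    show "0 \<le> 2 * f x * (M2 + s * deriv f x)"
      using density_classD(3,6)[OF f, of x] s by (intro mult_nonneg_nonneg) auto
  qed
  have "\<bar>f b - f a\<bar> \<le> f b + f a"
    using density_classD(3)[OF f, of a] density_classD(3)[OF f, of b] by auto
  \<comment> \<open>For nonnegative values the squared difference is at most the absolute difference
    of the squares, which the two monotone functions control.\<close>
  then have "\<bar>f b - f a\<bar> * \<bar>f b - f a\<bar> \<le> \<bar>f b - f a\<bar> * (f b + f a)"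
    by (intro mult_left_mono) auto
  also have "\<dots> = \<bar>(f b - f a) * (f b + f a)\<bar>"
    using density_classD(3)[OF f, of a] density_classD(3)[OF f, of b] by (simp add: abs_mult)
  also have "\<dots> = \<bar>(f b)\<^sup>2 - (f a)\<^sup>2\<bar>"
    by (simp add: power2_eq_square algebra_simps)
  also have "\<dots> \<le> 2 * M2 * (dcdf f b - dcdf f a)"
    using mono[of 1] mono[of "-1"] by (simp add: algebra_simps abs_le_iff)
  finally show ?thesis by (simp add: power2_eq_square)
qed

section \<open>Grids of quantile levels and the interpolated density\<close>

lemma levels_less:
  fixes \<tau> :: "nat \<Rightarrow> real"
  assumes "\<And>j. j \<le> m \<Longrightarrow> \<tau> j < \<tau> (Suc j)" "i < j" "j \<le> Suc m"
  shows "\<tau> i < \<tau> j"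
  using assms(2,3)
proof (induction j)
  case (Suc j)
  then show ?case using assms(1)[of j] by (cases "i = j") (auto intro: less_trans)
qed simp

lemma levels_in_unit_interval:
  fixes \<tau> :: "nat \<Rightarrow> real"
  assumes "\<tau> 0 = 0" "\<tau> (Suc m) = 1" "\<And>j. j \<le> m \<Longrightarrow> \<tau> j < \<tau> (Suc j)" "j \<in> {1..m}"
  shows "\<tau> j \<in> {0<..<1}"
  using levels_less[of m \<tau> 0 j] levels_less[of m \<tau> j "Suc m"] assms by auto

text \<open>This holds for unordered \<open>\<theta>\<close> as well: a cell whose indicator is
  nonzero has positive width, and on every other cell the product is 0 whatever the sign of the
  quotient.\<close>

lemma interp_density_nonneg:
  assumes "\<tau> 0 = 0" "\<tau> (Suc m) = 1" "\<And>j. j \<le> m \<Longrightarrow> \<tau> j < \<tau> (Suc j)"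
  shows "0 \<le> interp_density \<sigma> m \<tau> \<theta> y"
proof -
  have "0 \<le> \<tau> 1" "\<tau> m \<le> 1"
    using assms(3)[of 0] assms(3)[of m] assms(1,2) by auto
  moreover have "\<tau> j \<le> \<tau> (Suc j)" if "j < m" for j
    using assms(3)[of j] that by auto
  ultimately have "0 \<le> indicator {\<theta> j..<\<theta> (Suc j)} y * ((\<tau> (Suc j) - \<tau> j) / (\<theta> (Suc j) - \<theta> j))"
    if "j \<in> {1..<m}" for j
    using that by (cases "y \<in> {\<theta> j..<\<theta> (Suc j)}") auto
  with \<open>0 \<le> \<tau> 1\<close> \<open>\<tau> m \<le> 1\<close> show ?thesis
    unfolding interp_density_def left_half_normal_def right_half_normal_def
    by (intro add_nonneg_nonneg sum_nonneg) auto
qed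

text \<open>The scale \<open>k\<close> is kept apart from the number \<open>m\<close> of levels: the
  tail condition of the class is used at level \<open>1/k\<close>, which fits once every gap is
  below \<open>1/k\<close>. The bound is free of \<open>f\<close>, \<open>y\<close> and
  \<open>\<theta>\<close>, so it survives averaging over a fibre.\<close>

lemma interp_density_error:
  assumes f: "f \<in> density_class M1 M2 c"
    and ends: "\<tau> 0 = 0" "\<tau> (Suc m) = 1"
    and incr: "\<And>j. j \<le> m \<Longrightarrow> \<tau> j < \<tau> (Suc j)"
    and mesh: "\<And>j. j \<le> m \<Longrightarrow> \<tau> (Suc j) - \<tau> j < 1 / real k"
    and m: "1 \<le> m" and k: "2 \<le> k" and \<sigma>: "0 < \<sigma>"
    and \<theta>: "\<And>j. j \<in> {1..m} \<Longrightarrow> \<theta> j = quantile f (\<tau> j)"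
  shows "\<bar>f y - interp_density \<sigma> m \<tau> \<theta> y\<bar>
    \<le> (\<bar>c\<bar> + sqrt (2 * M2) + 2 * normal_density 0 \<sigma> 0) / sqrt (real k)"
proof -
  interpret real_distribution "density lborel (\<lambda>u. ennreal (f u))"
    by (rule real_distribution_density_class[OF f])
  note less = levels_less[of m \<tau>, OF incr]
  have unit: "\<tau> j \<in> {0<..<1}" if "j \<in> {1..m}" for j
    using levels_in_unit_interval[of \<tau> m j] ends incr that by blast
  have \<theta>_less: "\<theta> i < \<theta> j" if "1 \<le> i" "i < j" "j \<le> m" for i j
    using quantile_less[OF f, of "\<tau> i" "\<tau> j"] less[of i j] unit[of i] unit[of j] that
    by (auto simp: \<theta>)
  have \<theta>_le: "\<theta> i \<le> \<theta> j" if "1 \<le> i" "i \<le> j" "j \<le> m" for i j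
    using \<theta>_less[of i j] that by (cases "i = j") auto
  have M2: "0 \<le> M2" using density_classD(6)[OF f] by (smt (verit))
  have k0: "0 < sqrt (real k)" "1 / real k \<le> 1 / sqrt (real k)"
    using k by (auto intro!: divide_left_mono real_le_lsqrt simp: power2_eq_square)
  define N where "N = normal_density 0 \<sigma> 0"
  \<comment> \<open>A normal density is largest at its mean, so \<open>N\<close> serves both
    half-normal tails, wherever they are centred.\<close>
  have N: "0 \<le> N" "normal_density \<mu> \<sigma> y \<le> N" for \<mu>
    unfolding N_def by simp (simp add: normal_density_def divide_right_mono)
  have f0: "0 \<le> f y" by (rule density_classD(3)[OF f])
  have tail: "\<bar>f y - a * (2 * normal_density \<mu> \<sigma> y)\<bar> \<le> (\<bar>c\<bar> + 2 * N) / sqrt (real k)"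
    if "0 \<le> a" "a \<le> 1 / real k" "f y < c / sqrt (real k)" for a \<mu>
  proof -
    have "a * (2 * normal_density \<mu> \<sigma> y) \<le> (1 / sqrt (real k)) * (2 * N)"
      using that k0 N by (intro mult_mono) auto
    then have "a * (2 * normal_density \<mu> \<sigma> y) \<le> 2 * N / sqrt (real k)" by simp
    moreover have "0 \<le> a * (2 * normal_density \<mu> \<sigma> y)"
      using that by simp
    moreover have "c / sqrt (real k) \<le> \<bar>c\<bar> / sqrt (real k)"
      by (simp add: divide_right_mono)
    moreover have "0 \<le> \<bar>c\<bar> / sqrt (real k)" by simp
    ultimately show ?thesis
      using f0 that(3) unfolding add_divide_distrib by linarith
  qed
  have le: "(\<bar>c\<bar> + 2 * N) / sqrt (real k) \<le> (\<bar>c\<bar> + sqrt (2 * M2) + 2 * N) / sqrt (real k)"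
      "sqrt (2 * M2) / sqrt (real k) \<le> (\<bar>c\<bar> + sqrt (2 * M2) + 2 * N) / sqrt (real k)"
    using M2 N by (auto intro!: divide_right_mono)
  consider "y < \<theta> 1" | "\<theta> m \<le> y" | "\<theta> 1 \<le> y" "y < \<theta> m" by linarith
  then show ?thesis
  proof cases
    case 1
    have out: "indicator {\<theta> j..<\<theta> (Suc j)} y = (0::real)" if "j \<in> {1..<m}" for j
      using \<theta>_le[of 1 j] 1 that by (auto simp: indicator_def)
    have eq: "interp_density \<sigma> m \<tau> \<theta> y = \<tau> 1 * (2 * normal_density (\<theta> 1) \<sigma> y)"
      using 1 \<theta>_le[of 1 m] m out by (simp add: interp_density_def left_half_normal_def)
    \<comment> \<open>Since \<open>\<tau> 0 = 0\<close>, the gap with index 0 is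
      \<open>\<tau> 1\<close> itself. Hence \<open>y\<close> lies below the \<open>1/k\<close>
      quantile, where the class bounds \<open>f\<close>.\<close>
    have "\<tau> 1 < 1 / real k" using mesh[of 0] ends by simp
    moreover have "1 / real k < 1" using k by simp
    ultimately have "\<theta> 1 < quantile f (1 / real k)"
      using quantile_less[OF f, of "\<tau> 1"] unit[of 1] m \<theta>[of 1] by auto
    then have "f y < c / sqrt (real k)"
      using density_class_tails(1)[OF f k] 1 by auto
    then show ?thesis
      using tail[of "\<tau> 1" "\<theta> 1"] \<open>\<tau> 1 < 1 / real k\<close> unit[of 1] m le unfolding eq N_def by auto
  next
    case 2
    have out: "indicator {\<theta> j..<\<theta> (Suc j)} y = (0::real)" if "j \<in> {1..<m}" for j
      using \<theta>_le[of "Suc j" m] 2 that by (auto simp: indicator_def)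
    have eq: "interp_density \<sigma> m \<tau> \<theta> y = (1 - \<tau> m) * (2 * normal_density (\<theta> m) \<sigma> y)"
      using 2 \<theta>_le[of 1 m] m out by (simp add: interp_density_def right_half_normal_def)
    \<comment> \<open>The gap with index \<open>m\<close> is \<open>1 - \<tau> m\<close>, which puts
      \<open>y\<close> beyond the upper quantile in the same way.\<close>
    have "1 - \<tau> m < 1 / real k" using mesh[of m] ends by simp
    moreover have "0 < (real k - 1) / real k" "(real k - 1) / real k = 1 - 1 / real k"
      using k by (auto simp: field_simps)
    ultimately have "quantile f ((real k - 1) / real k) < \<theta> m"
      using quantile_less[OF f, of "(real k - 1) / real k" "\<tau> m"] unit[of m] m \<theta>[of m] by auto
    then have "f y < c / sqrt (real k)"
      using density_class_tails(2)[OF f k] 2 by auto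
    then show ?thesis
      using tail[of "1 - \<tau> m" "\<theta> m"] \<open>1 - \<tau> m < 1 / real k\<close> unit[of m] m le unfolding eq N_def by auto
  next
    case 3
    \<comment> \<open>The first quantile beyond \<open>y\<close> closes the cell of
      \<open>y\<close>. It is not the first of all, because \<open>\<theta> 1 \<le> y\<close>, so
      its predecessor \<open>j\<close> is a genuine index.\<close>
    define l where "l = (LEAST l. 1 \<le> l \<and> y < \<theta> l)"
    have l: "1 \<le> l \<and> y < \<theta> l" "l \<le> m" "\<And>i. i < l \<Longrightarrow> \<not> (1 \<le> i \<and> y < \<theta> i)"
      unfolding l_def using 3 m LeastI[of "\<lambda>l. 1 \<le> l \<and> y < \<theta> l" m]
        Least_le[of "\<lambda>l. 1 \<le> l \<and> y < \<theta> l" m] not_less_Least by auto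
    then obtain j where "l = Suc j" "j \<noteq> 0"
      using 3 by (cases l) (auto simp: not_less[symmetric])
    with l have j: "1 \<le> j" "j < m" "\<theta> j \<le> y" "y < \<theta> (Suc j)"
      by (auto simp: not_less[symmetric])
    have cell: "indicator {\<theta> i..<\<theta> (Suc i)} y * ((\<tau> (Suc i) - \<tau> i) / (\<theta> (Suc i) - \<theta> i))
        = (if i = j then (\<tau> (Suc j) - \<tau> j) / (\<theta> (Suc j) - \<theta> j) else 0)" if "i \<in> {1..<m}" for i
    proof (cases i j rule: linorder_cases)
      case less then show ?thesis using \<theta>_le[of "Suc i" j] j that by (auto simp: indicator_def)
    next
      case greater then show ?thesis using \<theta>_le[of "Suc j" i] j that by (auto simp: indicator_def)
    qed (use j in auto)
    have eq: "interp_density \<sigma> m \<tau> \<theta> y = (\<tau> (Suc j) - \<tau> j) / (\<theta> (Suc j) - \<theta> j)"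
      unfolding interp_density_def using 3 j by (subst sum.cong[OF refl cell]) auto
    have lt: "\<theta> j < \<theta> (Suc j)" using j \<theta>_less by auto
    have G: "dcdf f (\<theta> i) = \<tau> i" if "i \<in> {1..m}" for i
      using dcdf_quantile[OF f, of "\<tau> i"] unit[OF that] \<theta>[OF that] by auto
    \<comment> \<open>By the mean value theorem the height of the interpolation on the cell is a
      value of \<open>f\<close> there. It remains to bound the oscillation of \<open>f\<close>
      between \<open>y\<close> and \<open>z\<close>, which share a cell of mass below
      \<open>1/k\<close>.\<close>
    obtain z where z: "\<theta> j < z" "z < \<theta> (Suc j)"
      "dcdf f (\<theta> (Suc j)) - dcdf f (\<theta> j) = (\<theta> (Suc j) - \<theta> j) * f z"
      using MVT2[OF lt, of "dcdf f" f] has_real_derivative_dcdf[OF f] by blast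
    have fz: "interp_density \<sigma> m \<tau> \<theta> y = f z"
      using z G[of j] G[of "Suc j"] j lt unfolding eq by simp
    have "\<bar>dcdf f z - dcdf f y\<bar> \<le> dcdf f (\<theta> (Suc j)) - dcdf f (\<theta> j)"
      using z j cdf_nondecreasing[of "\<theta> j" z] cdf_nondecreasing[of "\<theta> j" y]
        cdf_nondecreasing[of z "\<theta> (Suc j)"] cdf_nondecreasing[of y "\<theta> (Suc j)"] by auto
    also have "\<dots> \<le> 1 / real k"
      using mesh[of j] G[of j] G[of "Suc j"] j by auto
    finally have "2 * M2 * \<bar>dcdf f z - dcdf f y\<bar> \<le> 2 * M2 * (1 / real k)"
      using M2 by (intro mult_left_mono) auto
    moreover have "(f y - f z)\<^sup>2 \<le> 2 * M2 * \<bar>dcdf f z - dcdf f y\<bar>"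
      using density_class_oscillation[OF f, of z y] density_class_oscillation[OF f, of y z]
        cdf_nondecreasing[of z y] cdf_nondecreasing[of y z]
      by (cases "z \<le> y") (auto simp: power2_commute)
    ultimately have "\<bar>f y - f z\<bar> \<le> sqrt (2 * M2 / real k)"
      by (intro real_le_rsqrt) simp
    then show ?thesis
      using le(2) unfolding fz N_def by (simp add: real_sqrt_divide)
  qed
qed

text \<open>The point \<open>y\<close> is fixed and the endpoints of the intervals vary, so the
  indicators are unfolded into comparisons of coordinates. With \<open>1 \<le> m\<close> the
  coordinates \<open>1\<close> and \<open>m\<close> belong to the index set.\<close>

lemma interp_density_measurable:
  assumes "1 \<le> m"
  shows "(\<lambda>\<theta>. interp_density \<sigma> m \<tau> \<theta> y) \<in> borel_measurable (PiM {1..m} (\<lambda>_. borel))"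
proof -
  have comp: "(\<lambda>\<theta>. \<theta> j) \<in> borel_measurable (PiM {1..m} (\<lambda>_. borel))" if "1 \<le> j" "j \<le> m" for j
    using that by (intro measurable_component_singleton) auto
  have [measurable]: "(\<lambda>\<theta>. \<theta> 1) \<in> borel_measurable (PiM {1..m} (\<lambda>_. borel))"
    "(\<lambda>\<theta>. \<theta> m) \<in> borel_measurable (PiM {1..m} (\<lambda>_. borel))"
    using assms comp by blast+
  have cell: "(\<lambda>\<theta>. indicator {\<theta> j..<\<theta> (Suc j)} y * ((\<tau> (Suc j) - \<tau> j) / (\<theta> (Suc j) - \<theta> j)))
      \<in> borel_measurable (PiM {1..m} (\<lambda>_. borel))" if "j \<in> {1..<m}" for j
  proof -
    have [measurable]: "(\<lambda>\<theta>. \<theta> j) \<in> borel_measurable (PiM {1..m} (\<lambda>_. borel))"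
      "(\<lambda>\<theta>. \<theta> (Suc j)) \<in> borel_measurable (PiM {1..m} (\<lambda>_. borel))"
      using that by (auto intro!: comp)
    show ?thesis
      unfolding indicator_def atLeastLessThan_iff by measurable
  qed
  show ?thesis
    unfolding interp_density_def left_half_normal_def right_half_normal_def normal_density_def
    by (intro borel_measurable_add borel_measurable_sum cell)
       (unfold indicator_def atLeast_iff lessThan_iff, measurable)
qed

section \<open>Measurability\<close>

lemma space_density_space [simp]: "space (density_space F) = F"
  by (simp add: density_space_def space_restrict_space space_PiM)

lemma measurable_eval_density_space [measurable]:
  "(\<lambda>f. f u) \<in> borel_measurable (density_space F)"
  unfolding density_space_def by (intro measurable_restrict_space1 measurable_component_singleton) simp

text \<open>The cylinder sigma-algebra provides evaluations at fixed points only. Rounding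
  \<open>u\<close> down to a grid leaves countably many evaluation points, and continuity of the
  paths recovers the joint evaluation as the mesh of the grid shrinks.\<close>

lemma measurable_joint_eval:
  assumes F: "\<And>f. f \<in> F \<Longrightarrow> continuous_on UNIV f"
  shows "(\<lambda>(f, u). f u) \<in> borel_measurable (density_space F \<Otimes>\<^sub>M (borel :: real measure))"
proof -
  let ?g = "\<lambda>k u. real_of_int \<lfloor>real (Suc k) * u\<rfloor> / real (Suc k)"
  have lim: "(\<lambda>k. ?g k u) \<longlonglongrightarrow> u" for u
  proof (rule tendsto_sandwich)
    have "u - 1 / real (Suc k) \<le> ?g k u" for k
    proof -
      have "real (Suc k) * u - 1 \<le> real_of_int \<lfloor>real (Suc k) * u\<rfloor>" by linarith
      then have "(real (Suc k) * u - 1) / real (Suc k) \<le> ?g k u"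
        by (rule divide_right_mono) simp
      then show ?thesis by (simp add: diff_divide_distrib)
    qed
    then show "\<forall>\<^sub>F k in sequentially. u - 1 / real (Suc k) \<le> ?g k u" by (intro always_eventually allI)
    have "?g k u \<le> u" for k
    proof -
      have "?g k u \<le> (real (Suc k) * u) / real (Suc k)"
        by (intro divide_right_mono of_int_floor_le) simp
      then show ?thesis by simp
    qed
    then show "\<forall>\<^sub>F k in sequentially. ?g k u \<le> u" by (intro always_eventually allI)
    show "(\<lambda>k. u - 1 / real (Suc k)) \<longlonglongrightarrow> u"
      using tendsto_diff[OF tendsto_const[of u] LIMSEQ_inverse_real_of_nat] by (simp add: inverse_eq_divide)
  qed simp
  show ?thesis
  proof (rule borel_measurable_LIMSEQ_real)
    fix fu :: "(real \<Rightarrow> real) \<times> real" assume "fu \<in> space (density_space F \<Otimes>\<^sub>M borel)"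
    then obtain f u where fu: "fu = (f, u)" "f \<in> F" by (auto simp: space_pair_measure)
    have "isCont f u" using F[OF fu(2)] by (simp add: continuous_on_eq_continuous_at)
    from isCont_tendsto_compose[OF this lim]
    show "(\<lambda>k. (\<lambda>(f, u). f (?g k u)) fu) \<longlonglongrightarrow> (\<lambda>(f, u). f u) fu"
      by (simp add: fu)
  next
    fix k
    \<comment> \<open>The integer-valued floor selects one of countably many measurable
      evaluations.\<close>
    have "(\<lambda>fu. (\<lambda>i fu. fst fu (real_of_int i / real (Suc k))) \<lfloor>real (Suc k) * snd fu\<rfloor> fu)
        \<in> borel_measurable (density_space F \<Otimes>\<^sub>M (borel :: real measure))"
      by (rule measurable_compose_countable) measurable
    then show "(\<lambda>(f, u). f (?g k u)) \<in> borel_measurable (density_space F \<Otimes>\<^sub>M (borel :: real measure))"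
      by (simp add: case_prod_unfold)
  qed
qed

text \<open>A sublevel set of the quantile is a superlevel set of the mass below \<open>a\<close>,
  and that mass is measurable in \<open>f\<close> by integrating the joint evaluation.\<close>

lemma measurable_quantile:
  assumes F: "F = density_class M1 M2 c" and t: "t \<in> {0<..<1}"
  shows "(\<lambda>f. quantile f t) \<in> borel_measurable (density_space F)"
proof (subst borel_measurable_iff_le, intro allI)
  fix a
  have "continuous_on UNIV f" if "f \<in> F" for f
    using density_classD(5)[OF that[unfolded F]]
    by (intro continuous_at_imp_continuous_on ballI DERIV_isCont) auto
  from measurable_joint_eval[OF this]
  have ev: "(\<lambda>(f, u). f u) \<in> borel_measurable (density_space F \<Otimes>\<^sub>M (lborel :: real measure))"
    by (simp cong: measurable_cong_sets sets_pair_measure_cong)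
  have "(\<lambda>(f, u). indicator {..a} u * f u) \<in> borel_measurable (density_space F \<Otimes>\<^sub>M (lborel :: real measure))"
    using ev by (auto simp: case_prod_unfold intro!: borel_measurable_times borel_measurable_indicator'
        measurable_compose[OF measurable_snd])
  then have [measurable]: "(\<lambda>f. \<integral>u. indicator {..a} u * f u \<partial>lborel) \<in> borel_measurable (density_space F)"
    by (rule lborel.borel_measurable_lebesgue_integral)
  have "{f \<in> space (density_space F). quantile f t \<le> a}
      = {f \<in> space (density_space F). t \<le> (\<integral>u. indicator {..a} u * f u \<partial>lborel)}"
    using quantile_le_iff[OF _ t] dcdf_eq_integral by (auto simp: F)
  also have "\<dots> \<in> sets (density_space F)" by measurable
  finally show "{f \<in> space (density_space F). quantile f t \<le> a} \<in> sets (density_space F)" .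
qed

text \<open>The domain of integration moves with \<open>\<theta>\<close>. Moving the fibre condition
  into the integrand gives a function jointly measurable in \<open>\<theta>\<close> and
  \<open>f\<close>, which can be integrated against the kernel.\<close>

lemma measurable_fibre_integral:
  assumes F: "F = density_class M1 M2 c" and \<tau>: "\<And>j. j \<in> {1..m} \<Longrightarrow> \<tau> j \<in> {0<..<1}"
    and K: "K \<in> PiM {1..m} (\<lambda>_. borel) \<rightarrow>\<^sub>M subprob_algebra (density_space F)"
  shows "(\<lambda>\<theta>. LINT f : density_fibre F m \<tau> \<theta> | K \<theta>. f y) \<in> borel_measurable (PiM {1..m} (\<lambda>_. borel))"
    (is "_ \<in> borel_measurable ?N")
proof -
  let ?D = "density_space F"
  have pred: "Measurable.pred (?N \<Otimes>\<^sub>M ?D) (\<lambda>p. quantile (snd p) (\<tau> j) = fst p j)" if j: "j \<in> {1..m}" for j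
  proof -
    have "(\<lambda>p. quantile (snd p) (\<tau> j)) \<in> borel_measurable (?N \<Otimes>\<^sub>M ?D)"
      by (rule measurable_compose[OF measurable_snd measurable_quantile[OF F \<tau>[OF j]]])
    moreover have "(\<lambda>p. fst p j) \<in> borel_measurable (?N \<Otimes>\<^sub>M ?D)"
      by (rule measurable_compose[OF measurable_fst measurable_component_singleton[OF j]])
    ultimately show ?thesis by measurable
  qed
  have [measurable]: "Measurable.pred (?N \<Otimes>\<^sub>M ?D) (\<lambda>p. \<forall>j\<in>{1..m}. quantile (snd p) (\<tau> j) = fst p j)"
    by (intro pred_intros_finite pred) auto
  let ?h = "\<lambda>\<theta> f. if \<forall>j\<in>{1..m}. quantile f (\<tau> j) = \<theta> j then f y else 0"
  have h: "(\<lambda>(\<theta>, f). ?h \<theta> f) \<in> borel_measurable (?N \<Otimes>\<^sub>M ?D)"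
    unfolding case_prod_unfold by measurable
  have "(LINT f : density_fibre F m \<tau> \<theta> | K \<theta>. f y) = enn2real (\<integral>\<^sup>+ f. ennreal (?h \<theta> f) \<partial>K \<theta>)"
    if \<theta>: "\<theta> \<in> space ?N" for \<theta>
  proof -
    have K\<theta>: "sets (K \<theta>) = sets ?D" "space (K \<theta>) = F"
      using measurable_space[OF K \<theta>] by (auto simp: space_subprob_algebra dest: sets_eq_imp_space_eq)
    have "(LINT f : density_fibre F m \<tau> \<theta> | K \<theta>. f y) = (\<integral>f. ?h \<theta> f \<partial>K \<theta>)"
      unfolding set_lebesgue_integral_def
      by (rule Bochner_Integration.integral_cong) (auto simp: K\<theta> density_fibre_def)
    also have "\<dots> = enn2real (\<integral>\<^sup>+ f. ennreal (?h \<theta> f) \<partial>K \<theta>)"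
    proof (rule integral_eq_nn_integral)
      have "?h \<theta> \<in> borel_measurable ?D"
        using measurable_compose[OF measurable_Pair1'[OF \<theta>] h] by simp
      then show "?h \<theta> \<in> borel_measurable (K \<theta>)"
        using K\<theta> by (simp cong: measurable_cong_sets)
      show "AE f in K \<theta>. 0 \<le> ?h \<theta> f"
        using density_classD(3) by (intro AE_I2) (auto simp: K\<theta> F)
    qed
    finally show ?thesis .
  qed
  moreover have "(\<lambda>\<theta>. \<integral>\<^sup>+ f. ennreal (?h \<theta> f) \<partial>K \<theta>) \<in> borel_measurable ?N"
    using h by (intro nn_integral_measurable_subprob_algebra2[OF _ K]) (simp add: case_prod_unfold)
  ultimately show ?thesis
    by (subst measurable_cong) auto
qed

section \<open>Comparison of posteriors\<close>

text \<open>Dividing all factors by \<open>C\<close> brings them into the unit ball, where the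
  difference of products is at most the sum of the differences of factors.\<close>

lemma abs_prod_diff_le:
  fixes a b :: "'i \<Rightarrow> real"
  assumes ab: "\<And>i. i \<in> I \<Longrightarrow> \<bar>a i\<bar> \<le> C" "\<And>i. i \<in> I \<Longrightarrow> \<bar>b i\<bar> \<le> C"
    and e: "\<And>i. i \<in> I \<Longrightarrow> \<bar>a i - b i\<bar> \<le> e" and C: "1 \<le> C"
  shows "\<bar>prod a I - prod b I\<bar> \<le> real (card I) * C ^ card I * e"
proof (cases "finite I")
  case True
  have scale: "(\<Prod>i\<in>I. u i / C) = prod u I / C ^ card I" for u :: "'i \<Rightarrow> real"
    by (simp add: prod_dividef)
  have "norm ((\<Prod>i\<in>I. a i / C) - (\<Prod>i\<in>I. b i / C)) \<le> (\<Sum>i\<in>I. norm (a i / C - b i / C))"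
    using ab C by (intro norm_prod_diff) (auto simp: abs_divide)
  also have "\<dots> \<le> (\<Sum>i\<in>I. e)"
  proof (rule sum_mono)
    fix i assume i: "i \<in> I"
    have "\<bar>a i - b i\<bar> / C \<le> \<bar>a i - b i\<bar> / 1"
      using C by (intro divide_left_mono) auto
    then show "norm (a i / C - b i / C) \<le> e"
      using e[OF i] C by (simp add: abs_divide flip: diff_divide_distrib)
  qed
  finally have "\<bar>prod a I - prod b I\<bar> / C ^ card I \<le> real (card I) * e"
    using C by (simp add: scale abs_divide flip: diff_divide_distrib)
  then show ?thesis
    using C by (simp add: divide_le_eq mult_ac)
\<comment> \<open>For infinite \<open>I\<close> both products are 1 and \<open>card I\<close> is
  0.\<close>
qed simp

text \<open>The formula covers zero evidence too: both sides are then 0 by the convention for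
  division by zero.\<close>

lemma measure_posterior:
  assumes L: "integrable \<pi> L" "AE B in \<pi>. 0 \<le> L B" and A: "A \<in> sets \<pi>"
  shows "measure (posterior \<pi> L) A = (\<integral>B. indicator A B * L B \<partial>\<pi>) / (\<integral>B. L B \<partial>\<pi>)"
proof -
  let ?Z = "\<integral>B. L B \<partial>\<pi>"
  note [measurable] = borel_measurable_integrable[OF L(1)]
  have Z: "0 \<le> ?Z" by (rule integral_nonneg_AE[OF L(2)])
  have i: "integrable \<pi> (\<lambda>B. indicator A B * L B / ?Z)"
    using integrable_mult_indicator[OF A L(1)] by simp
  have "emeasure (posterior \<pi> L) A = (\<integral>\<^sup>+B. ennreal (indicator A B * L B / ?Z) \<partial>\<pi>)"
    unfolding posterior_def using A
    by (subst emeasure_density) (auto intro!: nn_integral_cong simp: indicator_def)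
  also have "\<dots> = ennreal (\<integral>B. indicator A B * L B / ?Z \<partial>\<pi>)"
    using L(2) Z by (intro nn_integral_eq_integral[OF i]) (auto elim!: eventually_mono)
  finally have "emeasure (posterior \<pi> L) A = ennreal ((\<integral>B. indicator A B * L B \<partial>\<pi>) / ?Z)"
    by simp
  moreover have "0 \<le> (\<integral>B. indicator A B * L B \<partial>\<pi>)"
    using L(2) by (intro integral_nonneg_AE) (auto elim!: eventually_mono)
  ultimately show ?thesis
    using Z by (simp add: measure_def)
qed

text \<open>Uniform closeness of the likelihoods passes to every unnormalised mass and to the
  evidences. The condition \<open>e < Z\<close> keeps the second evidence positive.\<close>

lemma tv_dist_posterior_le:
  assumes \<pi>: "prob_space \<pi>"
    and L: "integrable \<pi> L" "AE B in \<pi>. 0 \<le> L B"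
    and L': "integrable \<pi> L'" "AE B in \<pi>. 0 \<le> L' B"
    and e: "AE B in \<pi>. \<bar>L B - L' B\<bar> \<le> e" "e < (\<integral>B. L B \<partial>\<pi>)"
  shows "0 \<le> tv_dist (posterior \<pi> L) (posterior \<pi> L')"
    and "tv_dist (posterior \<pi> L) (posterior \<pi> L') \<le> 2 * e / (\<integral>B. L B \<partial>\<pi>)"
proof -
  interpret prob_space \<pi> by (rule \<pi>)
  define Z Z' where "Z = (\<integral>B. L B \<partial>\<pi>)" and "Z' = (\<integral>B. L' B \<partial>\<pi>)"
  have ind: "integrable \<pi> (\<lambda>B. indicator A B * L B)" "integrable \<pi> (\<lambda>B. indicator A B * L' B)"
    if "A \<in> sets \<pi>" for A
    using integrable_mult_indicator[OF that L(1)] integrable_mult_indicator[OF that L'(1)] by auto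
  have close: "\<bar>(\<integral>B. indicator A B * L B \<partial>\<pi>) - (\<integral>B. indicator A B * L' B \<partial>\<pi>)\<bar> \<le> e"
    if A: "A \<in> sets \<pi>" for A
  proof -
    have "\<bar>\<integral>B. indicator A B * L B - indicator A B * L' B \<partial>\<pi>\<bar>
        \<le> (\<integral>B. \<bar>indicator A B * L B - indicator A B * L' B\<bar> \<partial>\<pi>)"
      by (rule integral_abs_bound)
    also have "\<dots> \<le> e"
    proof (rule integral_le_const)
      show "AE B in \<pi>. \<bar>indicator A B * L B - indicator A B * L' B\<bar> \<le> e"
        using e(1) by eventually_elim (auto simp: indicator_def)
    qed (use ind[OF A] in auto)
    finally show ?thesis using ind[OF A] by simp
  qed
  have space: "(\<integral>B. indicator (space \<pi>) B * l B \<partial>\<pi>) = (\<integral>B. l B \<partial>\<pi>)" for l :: "'a \<Rightarrow> real"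
    by (rule Bochner_Integration.integral_cong) auto
  have ZZ': "\<bar>Z - Z'\<bar> \<le> e"
    using close[OF sets.top] by (simp add: space Z_def Z'_def)
  have e0: "0 \<le> e" using ZZ' by linarith
  have Z: "0 < Z" using e(2) e0 by (simp add: Z_def)
  have Z': "0 < Z'" using e(2) ZZ' by (simp add: Z_def)
  have sup: "\<bar>measure (posterior \<pi> L) A - measure (posterior \<pi> L') A\<bar> \<le> 2 * e / Z"
    if A: "A \<in> sets \<pi>" for A
  proof -
    define I I' where "I = (\<integral>B. indicator A B * L B \<partial>\<pi>)" and "I' = (\<integral>B. indicator A B * L' B \<partial>\<pi>)"
    have I': "0 \<le> I'" "I' \<le> Z'"
      unfolding I'_def Z'_def using L' ind[OF A]
      by (auto intro!: integral_nonneg_AE integral_mono_AE elim!: eventually_mono simp: indicator_def)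
    \<comment> \<open>Splitting in this way bounds \<open>I' / Z'\<close> by 1 and leaves only
      \<open>Z\<close> in the denominators, so no lower bound on \<open>Z'\<close> enters the
      estimate.\<close>
    have "I / Z - I' / Z' = (I - I') / Z + (I' / Z') * ((Z' - Z) / Z)"
      using Z Z' by (simp add: field_simps)
    also have "\<bar>\<dots>\<bar> \<le> \<bar>(I - I') / Z\<bar> + \<bar>(I' / Z') * ((Z' - Z) / Z)\<bar>"
      by (rule abs_triangle_ineq)
    also have "\<dots> = \<bar>I - I'\<bar> / Z + (I' / Z') * (\<bar>Z' - Z\<bar> / Z)"
      using Z Z' I' by (simp add: abs_mult abs_divide)
    also have "\<dots> \<le> e / Z + 1 * (e / Z)"
      using close[OF A] ZZ' Z Z' I' unfolding I_def[symmetric] I'_def[symmetric]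
      by (intro add_mono mult_mono divide_right_mono) auto
    finally show ?thesis
      using measure_posterior[OF L A] measure_posterior[OF L' A]
      by (simp add: I_def I'_def Z_def Z'_def)
  qed
  have sets: "sets (posterior \<pi> L) = sets \<pi>" by (simp add: posterior_def)
  show "tv_dist (posterior \<pi> L) (posterior \<pi> L') \<le> 2 * e / (\<integral>B. L B \<partial>\<pi>)"
    unfolding tv_dist_def sets using sup sets.empty_sets by (intro cSUP_least) (auto simp: Z_def)
  \<comment> \<open>A real supremum dominates its members only when the set is bounded above; the
    empty event then contributes the value 0.\<close>
  have "bdd_above ((\<lambda>A. \<bar>measure (posterior \<pi> L) A - measure (posterior \<pi> L') A\<bar>) ` sets \<pi>)"
    using sup by (auto intro!: bdd_aboveI[of _ "2 * e / Z"])
  from cSUP_upper[OF sets.empty_sets this]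
  show "0 \<le> tv_dist (posterior \<pi> L) (posterior \<pi> L')"
    unfolding tv_dist_def sets by simp
qed

text \<open>Averaging against a probability measure carried by \<open>S\<close> preserves pointwise
  bounds. In the application \<open>a\<close> is the interpolated density, which is constant on a
  fibre.\<close>

lemma fibre_integral_bounds:
  assumes F: "F = density_class M1 M2 c"
    and K: "prob_space K" "sets K = sets (density_space F)" "emeasure K S = 1" "S \<subseteq> F"
    and e: "\<And>f. f \<in> S \<Longrightarrow> \<bar>f y - a\<bar> \<le> e"
  shows "\<bar>(LINT f : S | K. f y) - a\<bar> \<le> e" "0 \<le> (LINT f : S | K. f y)" "(LINT f : S | K. f y) \<le> M1"
proof -
  interpret prob_space K by (rule K)
  \<comment> \<open>A non-measurable set has measure 0 by convention, so mass 1 forces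
    measurability.\<close>
  have S [measurable]: "S \<in> sets K"
    using K(3) emeasure_notin_sets[of S K] by force
  have AE: "AE f in K. f \<in> S"
    using K(3) by (subst prob_eq_1[OF S, symmetric]) (simp add: measure_def)
  have [measurable]: "(\<lambda>f. f y) \<in> borel_measurable K"
    using K(2) by (simp cong: measurable_cong_sets)
  have bd: "0 \<le> f y" "f y \<le> M1" if "f \<in> S" for f
    using that K(4) density_classD[of f M1 M2 c] by (auto simp: F)
  have int: "integrable K (\<lambda>f. indicator S f * f y)"
  proof (rule integrable_const_bound[where B = "\<bar>M1\<bar>"])
    show "AE f in K. norm (indicator S f * f y) \<le> \<bar>M1\<bar>"
      using bd by (intro AE_I2) (force simp: indicator_def)
  qed measurable
  have eq: "(LINT f : S | K. f y) = (\<integral>f. indicator S f * f y \<partial>K)"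
    by (simp add: set_lebesgue_integral_def)
  have "AE f in K. a - e \<le> indicator S f * f y" "AE f in K. indicator S f * f y \<le> a + e"
    "AE f in K. 0 \<le> indicator S f * f y" "AE f in K. indicator S f * f y \<le> M1"
    using AE e bd by (auto elim!: eventually_mono simp: abs_le_iff algebra_simps dest: e)
  from integral_ge_const[OF int this(1)] integral_le_const[OF int this(2)]
    integral_ge_const[OF int this(3)] integral_le_const[OF int this(4)]
  show "\<bar>(LINT f : S | K. f y) - a\<bar> \<le> e" "0 \<le> (LINT f : S | K. f y)" "(LINT f : S | K. f y) \<le> M1"
    unfolding eq by auto
qed

section \<open>Dependence on the coefficients, and the size of the mesh\<close>

lemma measurable_fitted:
  "fitted x i m \<in> PiM {1..m} (\<lambda>_. borel) \<rightarrow>\<^sub>M PiM {1..m} (\<lambda>_. borel)"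
  unfolding fitted_def
  by (intro measurable_restrict borel_measurable_inner borel_measurable_const measurable_component_singleton)

lemma interp_likelihood_measurable:
  fixes x :: "nat \<Rightarrow> 'v::euclidean_space"
  assumes "1 \<le> m"
  shows "interp_likelihood \<sigma> n x y m \<tau> \<in> borel_measurable (PiM {1..m} (\<lambda>_. borel))"
  unfolding interp_likelihood_def
  by (intro borel_measurable_prod measurable_compose[OF measurable_fitted interp_density_measurable] assms)

lemma eventually_mesh_less:
  fixes d :: "nat \<Rightarrow> nat \<Rightarrow> real"
  assumes "(\<lambda>m. MAX j\<in>{0..m}. d m j) \<in> O(\<lambda>m. 1 / real m)" "0 < r"
  shows "\<forall>\<^sub>F m in sequentially. \<forall>j\<le>m. d m j < r"
proof -
  obtain C where C: "\<forall>\<^sub>F m in sequentially. norm (MAX j\<in>{0..m}. d m j) \<le> C * norm (1 / real m)"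
    using landau_o.bigE[OF assms(1)] by blast
  have "(\<lambda>m. C * norm (1 / real m)) \<longlonglongrightarrow> C * 0"
    by (intro tendsto_mult tendsto_const tendsto_norm_zero lim_1_over_n)
  then have "\<forall>\<^sub>F m in sequentially. C * norm (1 / real m) < r"
    using assms(2) by (intro order_tendstoD) auto
  with C show ?thesis
  proof eventually_elim
    case (elim m)
    show ?case
    proof (intro allI impI)
      fix j assume "j \<le> m"
      then have "d m j \<le> (MAX j\<in>{0..m}. d m j)" by (intro Max_ge) auto
      also have "\<dots> \<le> norm (MAX j\<in>{0..m}. d m j)" by (simp only: real_norm_def abs_ge_self)
      finally show "d m j < r" using elim by linarith
    qed
  qed
qed

theorem theorem3p2:
  fixes M :: "'w measure"
    and \<beta> :: "'w \<Rightarrow> real \<Rightarrow> real ^ 'p"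
    and n :: nat
    and x :: "nat \<Rightarrow> real ^ 'p"
    and first :: 'p
    and y :: "nat \<Rightarrow> real"
    and M1 M2 c \<sigma> :: real
    and F :: "(real \<Rightarrow> real) set"
    and P :: "'w measure"
    and \<tau> :: "nat \<Rightarrow> nat \<Rightarrow> real"
    and K :: "nat \<Rightarrow> nat \<Rightarrow> (nat \<Rightarrow> real) \<Rightarrow> (real \<Rightarrow> real) measure"
  assumes intercept: "\<And>i. i < n \<Longrightarrow> x i $ first = 1"
    and sigma: "0 < \<sigma>"
    and F: "F = density_class M1 M2 c"
    and prior: "gp_prior M \<beta>"
    and model: "measure M (model_event M \<beta> F n x) > 0"
    and P: "P = conditioned_on M (model_event M \<beta> F n x)"
    and levels_ends: "\<And>m. 1 \<le> m \<Longrightarrow> \<tau> m 0 = 0 \<and> \<tau> m (Suc m) = 1"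
    and levels_incr: "\<And>m j. 1 \<le> m \<Longrightarrow> j \<le> m \<Longrightarrow> \<tau> m j < \<tau> m (Suc j)"
    and levels_mesh:
      "(\<lambda>m. MAX j\<in>{0..m}. \<tau> m (Suc j) - \<tau> m j) \<in> O(\<lambda>m. 1 / real m)"
    and kernels: "\<And>m i. 1 \<le> m \<Longrightarrow> i < n \<Longrightarrow>
      disintegration (density_prior P \<beta> F x i) (fitted_prior P \<beta> x i m (\<tau> m))
        (density_fibre F m (\<tau> m)) (K m i)"
    and evidence: "(\<integral>\<omega>. (\<Prod>i<n. cond_density \<beta> F x i \<omega> (y i)) \<partial>P) > 0"
  shows "(\<lambda>m. tv_dist
            (posterior (coef_prior P \<beta> m (\<tau> m)) (interp_likelihood \<sigma> n x y m (\<tau> m)))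
            (posterior (coef_prior P \<beta> m (\<tau> m)) (integrated_likelihood F (K m) n x y m (\<tau> m))))
         \<longlonglongrightarrow> 0"
proof -
  define E where "E = model_event M \<beta> F n x"
  define A where "A = \<bar>c\<bar> + sqrt (2 * M2) + 2 * normal_density 0 \<sigma> 0"
  \<comment> \<open>\<open>C\<close> dominates the true densities and, with the error
    \<open>\<bar>A\<bar>\<close> added, the interpolated ones; the summand 1 ensures
    \<open>1 \<le> C\<close>. The sign of \<open>A\<close> is left open, since \<open>sqrt\<close>
    is negative at negative arguments.\<close>
  define C where "C = \<bar>M1\<bar> + 1 + \<bar>A\<bar>"
  define e where "e k = real n * C ^ n * (\<bar>A\<bar> / sqrt (real k))" for k :: nat
  define g where "g i \<omega> = cond_density \<beta> F x i \<omega>" for i \<omega>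
  define b where "b m \<omega> = (\<lambda>j\<in>{1..m}. \<beta> \<omega> (\<tau> m j))" for m \<omega>
  define Z where "Z = (\<integral>\<omega>. (\<Prod>i<n. g i \<omega> (y i)) \<partial>P)"
  have Z: "0 < Z" using evidence by (simp add: Z_def g_def)
  \<comment> \<open>A non-integrable function has Bochner integral 0, so positive evidence implies
    integrability.\<close>
  then have intZ: "integrable P (\<lambda>\<omega>. \<Prod>i<n. g i \<omega> (y i))"
    unfolding Z_def using not_integrable_integral_eq by fastforce
  \<comment> \<open>Positive measure again forces measurability of the event.\<close>
  have E: "E \<in> sets M"
    using model measure_notin_sets[of E M] by (auto simp: E_def)
  have E': "E \<in> sets (restrict_space M E)" "E \<inter> space M = E"
    using E sets.sets_into_space[OF E] by (auto simp: sets_restrict_space_iff)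
  have P: "P = uniform_measure (restrict_space M E) E"
    using P by (simp add: conditioned_on_def E_def)
  have M: "prob_space M" using prior by (simp add: gp_prior_def)
  have emE: "emeasure (restrict_space M E) E = emeasure M E"
    using E E' by (subst emeasure_restrict_space) auto
  interpret M: prob_space M by (rule M)
  interpret P: prob_space P
    unfolding P using model emE
    by (intro prob_space_uniform_measure) (auto simp: E_def M.emeasure_eq_measure)
  have setsP: "sets P = sets (restrict_space M E)" and spaceP: "space P = E"
    using E' by (auto simp: P space_restrict_space)
  have \<beta>_meas: "(\<lambda>\<omega>. \<beta> \<omega> t) \<in> borel_measurable P" if "t \<in> {0<..<1}" for t
    using prior that measurable_restrict_space1[of "\<lambda>\<omega>. \<beta> \<omega> t" M borel E] setsP
    by (auto simp: gp_prior_def cong: measurable_cong_sets)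
  have g: "g i \<omega> \<in> F" "t \<in> {0<..<1} \<Longrightarrow> quantile (g i \<omega>) t = x i \<bullet> \<beta> \<omega> t"
    if "i < n" "\<omega> \<in> E" for i \<omega> t
  proof -
    obtain f where "f \<in> F" "has_quantile_function f (\<lambda>t. x i \<bullet> \<beta> \<omega> t)"
      using \<open>\<omega> \<in> E\<close> \<open>i < n\<close> by (auto simp: E_def model_event_def)
    from density_of_in[OF this[unfolded F]]
    show "g i \<omega> \<in> F" "t \<in> {0<..<1} \<Longrightarrow> quantile (g i \<omega>) t = x i \<bullet> \<beta> \<omega> t"
      by (auto simp: g_def cond_density_def F has_quantile_function_def)
  qed

  \<comment> \<open>Bound on the total variation at a fixed scale \<open>k\<close>\<close>
  have C: "1 \<le> C" by (simp add: C_def)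
  have e0: "0 \<le> e k" for k using C by (simp add: e_def)
  have bound: "0 \<le> tv_dist
            (posterior (coef_prior P \<beta> m (\<tau> m)) (interp_likelihood \<sigma> n x y m (\<tau> m)))
            (posterior (coef_prior P \<beta> m (\<tau> m)) (integrated_likelihood F (K m) n x y m (\<tau> m)))
      \<and> tv_dist
            (posterior (coef_prior P \<beta> m (\<tau> m)) (interp_likelihood \<sigma> n x y m (\<tau> m)))
            (posterior (coef_prior P \<beta> m (\<tau> m)) (integrated_likelihood F (K m) n x y m (\<tau> m)))
         \<le> 4 * e k / Z"
    if m: "1 \<le> m" and k: "2 \<le> k" and ek: "e k < Z / 2"
      and mesh: "\<And>j. j \<le> m \<Longrightarrow> \<tau> m (Suc j) - \<tau> m j < 1 / real k" for m k
  proof -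
    let ?\<pi> = "coef_prior P \<beta> m (\<tau> m)" and ?N = "PiM {1..m} (\<lambda>_. borel) :: (nat \<Rightarrow> real) measure"
    let ?L = "interp_likelihood \<sigma> n x y m (\<tau> m)" and ?L' = "integrated_likelihood F (K m) n x y m (\<tau> m)"
    have ends: "\<tau> m 0 = 0" "\<tau> m (Suc m) = 1" using levels_ends[OF m] by auto
    note incr = levels_incr[OF m]
    have unit: "\<tau> m j \<in> {0<..<1}" if "j \<in> {1..m}" for j
      using levels_in_unit_interval[of "\<tau> m" m j] ends incr that by blast
    have b: "b m \<in> P \<rightarrow>\<^sub>M PiM {1..m} (\<lambda>_. borel)"
      unfolding b_def by (intro measurable_restrict \<beta>_meas unit)
    have \<pi>: "?\<pi> = distr P (PiM {1..m} (\<lambda>_. borel)) (b m)"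
      unfolding coef_prior_def b_def ..
    interpret \<pi>: prob_space ?\<pi> unfolding \<pi> by (rule P.prob_space_distr[OF b])
    have sets\<pi>: "sets ?\<pi> = sets (PiM {1..m} (\<lambda>_. borel))" by (simp add: \<pi>)
    have dens: "\<bar>f (y i) - interp_density \<sigma> m (\<tau> m) \<theta> (y i)\<bar> \<le> \<bar>A\<bar> / sqrt (real k)"
      if "f \<in> F" "\<And>j. j \<in> {1..m} \<Longrightarrow> \<theta> j = quantile f (\<tau> m j)" for f \<theta> i
    proof -
      have "\<bar>f (y i) - interp_density \<sigma> m (\<tau> m) \<theta> (y i)\<bar> \<le> A / sqrt (real k)"
        unfolding A_def
        by (rule interp_density_error[OF that(1)[unfolded F] ends incr mesh m k sigma that(2)])
      also have "\<dots> \<le> \<bar>A\<bar> / sqrt (real k)" by (intro divide_right_mono) auto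
      finally show ?thesis .
    qed
    have nonneg: "0 \<le> interp_density \<sigma> m (\<tau> m) \<theta> v" for \<theta> v
      by (rule interp_density_nonneg[OF ends incr])
    have sqk: "\<bar>A\<bar> / sqrt (real k) \<le> \<bar>A\<bar>"
      using k divide_left_mono[of 1 "sqrt (real k)" "\<bar>A\<bar>"] by simp
    \<comment> \<open>Used twice: with the true densities as \<open>v\<close>, to compare evidences,
      and with the fibre averages as \<open>v\<close>, to compare likelihoods.\<close>
    have prods: "\<bar>(\<Prod>i<n. interp_density \<sigma> m (\<tau> m) (\<theta> i) (y i)) - (\<Prod>i<n. v i)\<bar> \<le> e k"
      if v: "\<And>i. i < n \<Longrightarrow> 0 \<le> v i" "\<And>i. i < n \<Longrightarrow> v i \<le> M1"
        "\<And>i. i < n \<Longrightarrow> \<bar>v i - interp_density \<sigma> m (\<tau> m) (\<theta> i) (y i)\<bar> \<le> \<bar>A\<bar> / sqrt (real k)" for v \<theta>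
    proof -
      have "\<bar>interp_density \<sigma> m (\<tau> m) (\<theta> i) (y i)\<bar> \<le> C \<and> \<bar>v i\<bar> \<le> C" if "i < n" for i
        using v[OF that] sqk nonneg unfolding C_def by (auto simp: abs_le_iff)
      then show ?thesis
        unfolding e_def using v(3) C
          abs_prod_diff_le[of "{..<n}" "\<lambda>i. interp_density \<sigma> m (\<tau> m) (\<theta> i) (y i)" C v "\<bar>A\<bar> / sqrt (real k)"]
        by (auto simp: abs_minus_commute)
    qed
    have near: "\<bar>?L (b m \<omega>) - (\<Prod>i<n. g i \<omega> (y i))\<bar> \<le> e k" if \<omega>: "\<omega> \<in> E" for \<omega>
      unfolding interp_likelihood_def
    proof (rule prods)
      fix i assume i: "i < n"
      show "0 \<le> g i \<omega> (y i)" "g i \<omega> (y i) \<le> M1"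
        using density_classD(3,4)[OF g(1)[OF i \<omega>, unfolded F]] by auto
      show "\<bar>g i \<omega> (y i) - interp_density \<sigma> m (\<tau> m) (fitted x i m (b m \<omega>)) (y i)\<bar> \<le> \<bar>A\<bar> / sqrt (real k)"
        using g(1)[OF i \<omega>] g(2)[OF i \<omega> unit]
        by (intro dens) (auto simp: fitted_def b_def)
    qed
    define good where "good i B \<longleftrightarrow> (let I = LINT f : density_fibre F m (\<tau> m) (fitted x i m B) | K m i (fitted x i m B). f (y i)
      in 0 \<le> I \<and> I \<le> M1 \<and> \<bar>I - interp_density \<sigma> m (\<tau> m) (fitted x i m B) (y i)\<bar> \<le> \<bar>A\<bar> / sqrt (real k))" for i B
    have kern: "K m i \<in> ?N \<rightarrow>\<^sub>M prob_algebra (density_space F)" (is ?K1)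
      and good_AE: "AE B in ?\<pi>. good i B" (is ?K2) if i: "i < n" for i
    proof -
      note dis = kernels[OF m i, unfolded disintegration_def]
      have eqs: "sets (fitted_prior P \<beta> x i m (\<tau> m)) = sets ?N"
        by (simp add: fitted_prior_def)
      \<comment> \<open>The kernel takes values in the probability measures over
        \<open>density_prior\<close>, a space that depends only on the sigma-algebra, here that of
        \<open>density_space F\<close>.\<close>
      have eqp: "prob_algebra (density_prior P \<beta> F x i) = prob_algebra (density_space F)"
          unfolding prob_algebra_def
        subprob_algebra_cong[of "density_prior P \<beta> F x i" "density_space F", unfolded density_prior_def, OF sets_distr]
        density_prior_def ..
      show ?K1
        using dis eqp measurable_cong_sets[OF eqs refl] by auto
      have fit: "fitted x i m \<in> ?\<pi> \<rightarrow>\<^sub>M ?N"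
        using measurable_fitted measurable_cong_sets[OF sets\<pi> refl] by blast
      \<comment> \<open>The prior of the fitted quantiles is an image of the coefficient prior, so
        its null sets pull back along \<open>fitted\<close>.\<close>
      have "AE \<theta> in distr ?\<pi> ?N (fitted x i m). emeasure (K m i \<theta>) (density_fibre F m (\<tau> m) \<theta>) = 1"
        using dis unfolding fitted_prior_def by blast
      from AE_distrD[OF fit this] show ?K2
      proof (rule AE_mp, intro AE_I2 impI)
        fix B assume B: "B \<in> space ?\<pi>"
          and one: "emeasure (K m i (fitted x i m B)) (density_fibre F m (\<tau> m) (fitted x i m B)) = 1"
        have "K m i (fitted x i m B) \<in> space (prob_algebra (density_space F))"
          using \<open>?K1\<close> measurable_space[OF fit B] by (rule measurable_space)
        then have "prob_space (K m i (fitted x i m B))"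
          "sets (K m i (fitted x i m B)) = sets (density_space F)"
          by (auto simp: space_prob_algebra)
        from fibre_integral_bounds[OF F this one, of "y i" "interp_density \<sigma> m (\<tau> m) (fitted x i m B) (y i)"
            "\<bar>A\<bar> / sqrt (real k)"] dens
        show "good i B" by (auto simp: good_def density_fibre_def)
      qed
    qed
    have all_good: "AE B in ?\<pi>. \<forall>i\<in>{..<n}. good i B"
      using good_AE by (intro AE_finite_allI) auto
    have close: "\<bar>?L B - ?L' B\<bar> \<le> e k \<and> 0 \<le> ?L' B \<and> ?L' B \<le> C ^ n" if "\<forall>i\<in>{..<n}. good i B" for B
    proof -
      let ?I = "\<lambda>i. LINT f : density_fibre F m (\<tau> m) (fitted x i m B) | K m i (fitted x i m B). f (y i)"
      have I: "0 \<le> ?I i" "?I i \<le> M1"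
        "\<bar>?I i - interp_density \<sigma> m (\<tau> m) (fitted x i m B) (y i)\<bar> \<le> \<bar>A\<bar> / sqrt (real k)" if "i < n" for i
        using \<open>\<forall>i\<in>{..<n}. good i B\<close> that by (auto simp: good_def Let_def)
      have "(\<Prod>i<n. ?I i) \<le> (\<Prod>i<n. C)"
        using I(1,2) unfolding C_def by (intro prod_mono) fastforce
      moreover have "0 \<le> (\<Prod>i<n. ?I i)"
        using I(1) by (intro prod_nonneg) auto
      ultimately show ?thesis
        unfolding interp_likelihood_def integrated_likelihood_def using prods[of ?I, OF I] by simp
    qed
    have L_nonneg: "0 \<le> ?L B" for B
      unfolding interp_likelihood_def by (intro prod_nonneg) (auto intro: nonneg)
    have L_meas: "?L \<in> borel_measurable (PiM {1..m} (\<lambda>_. borel))"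
      by (rule interp_likelihood_measurable[OF m])
    have L'_meas: "?L' \<in> borel_measurable (PiM {1..m} (\<lambda>_. borel))"
      unfolding integrated_likelihood_def
      by (intro borel_measurable_prod measurable_compose[OF measurable_fitted measurable_fibre_integral[OF F unit]]
          measurable_prob_algebraD kern) auto
    \<comment> \<open>The interpolated heights may be large on narrow cells, so the bound comes from
      \<open>?L'\<close>: almost everywhere \<open>?L\<close> is within \<open>e k\<close> of
      it.\<close>
    have L: "integrable ?\<pi> ?L"
    proof (rule \<pi>.integrable_const_bound[where B = "C ^ n + e k"])
      show "AE B in ?\<pi>. norm (?L B) \<le> C ^ n + e k"
        using all_good by eventually_elim (use close L_nonneg in \<open>force simp: abs_le_iff\<close>)
    qed (use L_meas measurable_cong_sets[OF sets\<pi> refl] in blast)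
    have L': "integrable ?\<pi> ?L'"
    proof (rule \<pi>.integrable_const_bound[where B = "C ^ n"])
      show "AE B in ?\<pi>. norm (?L' B) \<le> C ^ n"
        using all_good by eventually_elim (use close in force)
    qed (use L'_meas measurable_cong_sets[OF sets\<pi> refl] in blast)
    have intL: "integrable P (\<lambda>\<omega>. ?L (b m \<omega>))"
      using L unfolding \<pi> by (subst (asm) integrable_distr_eq[OF b L_meas])
    \<comment> \<open>Pulled back to \<open>P\<close>, the interpolated evidence falls short of
      \<open>Z\<close> by at most \<open>e k\<close>, which is below \<open>Z / 2\<close>. This
      bounds the denominator from below independently of \<open>m\<close>.\<close>
    have "(\<integral>B. ?L B \<partial>?\<pi>) = (\<integral>\<omega>. ?L (b m \<omega>) \<partial>P)"
      unfolding \<pi> by (rule integral_distr[OF b L_meas])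
    moreover have "Z - (\<integral>\<omega>. ?L (b m \<omega>) \<partial>P) = (\<integral>\<omega>. (\<Prod>i<n. g i \<omega> (y i)) - ?L (b m \<omega>) \<partial>P)"
      unfolding Z_def using intZ intL by simp
    moreover have "(\<integral>\<omega>. (\<Prod>i<n. g i \<omega> (y i)) - ?L (b m \<omega>) \<partial>P) \<le> e k"
      using near spaceP intZ intL
      by (intro P.integral_le_const) (auto intro!: AE_I2 simp: abs_le_iff algebra_simps)
    ultimately have ZL: "Z / 2 \<le> (\<integral>B. ?L B \<partial>?\<pi>)" using ek by linarith
    have "AE B in ?\<pi>. \<bar>?L B - ?L' B\<bar> \<le> e k" "AE B in ?\<pi>. 0 \<le> ?L' B"
      using all_good by (auto elim!: eventually_mono dest: close)
    note tv = tv_dist_posterior_le[OF \<pi>.prob_space_axioms L AE_I2[OF L_nonneg] L' this(2) this(1)]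
    have "2 * e k / (\<integral>B. ?L B \<partial>?\<pi>) \<le> 2 * e k / (Z / 2)"
      using ZL Z e0 by (intro divide_left_mono) auto
    also have "\<dots> = 4 * e k / Z" by simp
    finally show ?thesis
      using tv ZL ek by linarith
  qed

  \<comment> \<open>Passage to the limit\<close>
  have "(\<lambda>k. real n * C ^ n * (\<bar>A\<bar> * (1 / sqrt (real k)))) \<longlonglongrightarrow> real n * C ^ n * (\<bar>A\<bar> * 0)"
    by (intro tendsto_mult tendsto_const tendsto_divide_0[OF tendsto_const] filterlim_compose[OF filterlim_at_top_imp_at_infinity]
        filterlim_compose[OF sqrt_at_top] filterlim_real_sequentially filterlim_at_top_imp_at_infinity)
  then have e_lim: "e \<longlonglongrightarrow> 0" by (simp add: e_def[abs_def])
  show ?thesis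
  proof (rule tendstoI)
    fix r :: real assume r: "0 < r"
    \<comment> \<open>The scale \<open>k\<close> is fixed first, from \<open>r\<close> and
      \<open>Z\<close> alone; only then is \<open>m\<close> taken large enough to bring the mesh
      below \<open>1/k\<close>.\<close>
    have "\<forall>\<^sub>F k in sequentially. e k < min (Z / 2) (r * Z / 4) \<and> 2 \<le> k"
      using Z r by (intro eventually_conj order_tendstoD(2)[OF e_lim] eventually_ge_at_top) auto
    then obtain k where k: "e k < Z / 2" "e k < r * Z / 4" "2 \<le> k"
      by (auto simp: eventually_sequentially)
    have "\<forall>\<^sub>F m in sequentially. 1 \<le> m \<and> (\<forall>j\<le>m. \<tau> m (Suc j) - \<tau> m j < 1 / real k)"
      using k(3) by (intro eventually_conj eventually_ge_at_top eventually_mesh_less[OF levels_mesh]) auto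
    then show "\<forall>\<^sub>F m in sequentially. dist (tv_dist
            (posterior (coef_prior P \<beta> m (\<tau> m)) (interp_likelihood \<sigma> n x y m (\<tau> m)))
            (posterior (coef_prior P \<beta> m (\<tau> m)) (integrated_likelihood F (K m) n x y m (\<tau> m)))) 0 < r"
    proof eventually_elim
      case (elim m)
      have "4 * e k / Z < r" using k Z by (simp add: field_simps)
      then show ?case using bound[of m k] elim k by (auto simp: dist_real_def)
    qed
  qed
qed

end
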